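(* Let $X$ be a uniform space whose uniformity is generated by a saturated family of pseudometrics $\{d_\lambda\}_{\lambda\in\Lambda}$, let $E$ be a subset of $X$ and let $T:E\to\mathcal{CB}(X)$ be an $\mathcal{H}$-continuous multi-function. Then $T$ is weakly continuous.
   Context: The family $\{d_\lambda\}_{\lambda\in\Lambda}$ is saturated if for all $\lambda,\mu\in\Lambda$ there is $\nu\in\Lambda$ with $\max\{d_\lambda,d_\mu\}\le d_\nu$ on $X\times X$. For $U$ in the uniformity $\mathcal{U}$ of $X$, $U[x]=\{y:(x,y)\in U\}$, $U[A]=\bigcup_{x\in A}U[x]$. A set $B\subseteq X$ is bounded if $B\subseteq U[x]$ for some $x\in X$, $U\in\mathcal{U}$; $\mathcal{CB}(X)$ is the family of closed, bounded, nonempty subsets of $X$. The $\mathcal{H}$-topology on $\mathcal{CB}(X)$ is the topology of the uniformity with fundamental entourages $H_U=\{(A,B):A\subseteq U[B],\ B\subseteq U[A]\}$, $U\in\mathcal{U}$; it is generated by the (Hausdorff) pseudometrics $H^\lambda(A,B)=\max\{\sup_{x\in A}d_\lambda(x,B),\sup_{y\in B}d_\lambda(y,A)\}$, where $d_\lambda(a,A)=\inf_{x\in A}d_\lambda(a,x)$. $\mathcal{H}$-continuity means continuity with respect to this topology. $T$ is weakly continuous if for every $\lambda\in\Lambda$ and $\alpha\ge0$ both sets $\{x\in E:d_\lambda(x,Tx)<\alpha\}$ and $\{x\in E:d_\lambda(x,Tx)>\alpha\}$ are open in $E$. *)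

theory Defs
  imports "HOL-Analysis.Analysis"
begin

definition pseudometric :: "('a \<Rightarrow> 'a \<Rightarrow> real) \<Rightarrow> bool" where
  "pseudometric \<rho> \<longleftrightarrow>
     (\<forall>x y. 0 \<le> \<rho> x y) \<and> (\<forall>x. \<rho> x x = 0) \<and>
     (\<forall>x y. \<rho> x y = \<rho> y x) \<and> (\<forall>x y z. \<rho> x z \<le> \<rho> x y + \<rho> y z)"

definition saturated :: "'l set \<Rightarrow> ('l \<Rightarrow> 'a \<Rightarrow> 'a \<Rightarrow> real) \<Rightarrow> bool" where
  "saturated \<Lambda> d \<longleftrightarrow>
     (\<forall>l\<in>\<Lambda>. \<forall>m\<in>\<Lambda>. \<exists>n\<in>\<Lambda>. \<forall>x y. max (d l x y) (d m x y) \<le> d n x y)"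

definition generates_uniformity ::
    "'l set \<Rightarrow> ('l \<Rightarrow> 'a::uniform_space \<Rightarrow> 'a \<Rightarrow> real) \<Rightarrow> bool" where
  "generates_uniformity \<Lambda> d \<longleftrightarrow>
     uniformity = (INF l\<in>\<Lambda>. INF e\<in>{0<..}. principal {(x, y). d l x y < e})"

definition entourage :: "('a::uniform_space \<times> 'a) set \<Rightarrow> bool" where
  "entourage U \<longleftrightarrow> (\<forall>\<^sub>F p in uniformity. p \<in> U)"

text \<open>
  For an entourage \<open>U\<close>, the sets \<open>U[x]\<close> and \<open>U[A]\<close> are the relational images
  \<open>U `` {x}\<close> and \<open>U `` A\<close>. Boundedness is relative to the uniformity alone; as the whole
  product is an entourage, this definition, read literally, excludes no set of a
  nonempty space.
\<close>

definition unif_bounded :: "'a::uniform_space set \<Rightarrow> bool" where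
  "unif_bounded B \<longleftrightarrow> (\<exists>x U. entourage U \<and> B \<subseteq> U `` {x})"

definition CB :: "'a::uniform_space set set" where
  "CB = {A. closed A \<and> unif_bounded A \<and> A \<noteq> {}}"

definition hyper_entourage ::
    "('a::uniform_space \<times> 'a) set \<Rightarrow> ('a set \<times> 'a set) set" where
  "hyper_entourage U = {(A, B). A \<in> CB \<and> B \<in> CB \<and> A \<subseteq> U `` B \<and> B \<subseteq> U `` A}"

definition hyper_uniformity :: "('a::uniform_space set \<times> 'a set) filter" where
  "hyper_uniformity = (INF U\<in>{U. entourage U}. principal (hyper_entourage U))"

text \<open>
  The topology on the carrier \<open>CB\<close> is obtained from the uniformity exactly as in
  the class axiom \<open>open_uniformity\<close>.
\<close>

definition H_topology :: "'a::uniform_space set topology" where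
  "H_topology = topology (\<lambda>W. W \<subseteq> CB \<and>
     (\<forall>A\<in>W. \<forall>\<^sub>F (A', B) in hyper_uniformity. A' = A \<longrightarrow> B \<in> W))"

lemma openin_H_topology:
  "openin H_topology W \<longleftrightarrow> W \<subseteq> CB \<and>
     (\<forall>A\<in>W. \<forall>\<^sub>F (A', B) in hyper_uniformity. A' = A \<longrightarrow> B \<in> W)"
proof -
  have "istopology (\<lambda>W :: 'a set set. W \<subseteq> CB \<and>
     (\<forall>A\<in>W. \<forall>\<^sub>F (A', B) in hyper_uniformity. A' = A \<longrightarrow> B \<in> W))"
    unfolding istopology_def
  proof (intro conjI allI impI ballI)
    fix S T :: "'a set set" and A
    assume S: "S \<subseteq> CB \<and> (\<forall>A\<in>S. \<forall>\<^sub>F (A', B) in hyper_uniformity. A' = A \<longrightarrow> B \<in> S)"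
      and T: "T \<subseteq> CB \<and> (\<forall>A\<in>T. \<forall>\<^sub>F (A', B) in hyper_uniformity. A' = A \<longrightarrow> B \<in> T)"
    show "S \<inter> T \<subseteq> CB" using S by blast
    assume "A \<in> S \<inter> T"
    then have "\<forall>\<^sub>F (A', B) in hyper_uniformity. A' = A \<longrightarrow> B \<in> S"
      "\<forall>\<^sub>F (A', B) in hyper_uniformity. A' = A \<longrightarrow> B \<in> T"
      using S T by auto
    then show "\<forall>\<^sub>F (A', B) in hyper_uniformity. A' = A \<longrightarrow> B \<in> S \<inter> T"
      by eventually_elim auto
  next
    fix K :: "'a set set set" and A
    assume K: "\<forall>S\<in>K. S \<subseteq> CB \<and>
      (\<forall>A\<in>S. \<forall>\<^sub>F (A', B) in hyper_uniformity. A' = A \<longrightarrow> B \<in> S)"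
    show "\<Union>K \<subseteq> CB" using K by blast
    assume "A \<in> \<Union>K"
    then obtain S where S: "S \<in> K" "A \<in> S" by blast
    then have "\<forall>\<^sub>F (A', B) in hyper_uniformity. A' = A \<longrightarrow> B \<in> S"
      using K by blast
    then show "\<forall>\<^sub>F (A', B) in hyper_uniformity. A' = A \<longrightarrow> B \<in> \<Union>K"
      by eventually_elim (use S in auto)
  qed
  then show ?thesis
    by (simp add: H_topology_def topology_inverse')
qed

lemma eventually_hyper_uniformity:
  "eventually P hyper_uniformity \<longleftrightarrow>
     (\<exists>U. entourage U \<and> (\<forall>p\<in>hyper_entourage U. P p))"
proof -
  have "eventually P hyper_uniformity \<longleftrightarrow>
    (\<exists>U\<in>{U. entourage U}. eventually P (principal (hyper_entourage U)))"
    unfolding hyper_uniformity_def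
  proof (rule eventually_INF_base)
    show "{U :: ('a \<times> 'a) set. entourage U} \<noteq> {}"
      by (auto simp: entourage_def intro: exI[of _ UNIV])
  next
    fix U V :: "('a \<times> 'a) set"
    assume "U \<in> {U. entourage U}" "V \<in> {U. entourage U}"
    then have "entourage (U \<inter> V)"
      by (auto simp: entourage_def eventually_conj_iff)
    moreover have "hyper_entourage (U \<inter> V) \<subseteq> hyper_entourage U \<inter> hyper_entourage V"
      unfolding hyper_entourage_def by blast
    ultimately show "\<exists>W\<in>{U. entourage U}. principal (hyper_entourage W)
        \<le> inf (principal (hyper_entourage U)) (principal (hyper_entourage V))"
      by auto
  qed
  then show ?thesis by (simp add: eventually_principal)
qed

lemma topspace_H_topology: "topspace H_topology = CB"
proof
  show "topspace H_topology \<subseteq> CB"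
    using openin_H_topology[of "topspace H_topology"] openin_topspace by blast
  have "openin H_topology (CB :: 'a set set)"
    by (auto simp: openin_H_topology eventually_hyper_uniformity entourage_def
        hyper_entourage_def intro!: exI[of _ UNIV])
  then show "(CB :: 'a set set) \<subseteq> topspace H_topology"
    by (rule openin_subset)
qed

definition H_continuous_on :: "'a::uniform_space set \<Rightarrow> ('a \<Rightarrow> 'a set) \<Rightarrow> bool" where
  "H_continuous_on E T \<longleftrightarrow> continuous_map (top_of_set E) H_topology T"

definition set_dist :: "('a \<Rightarrow> 'a \<Rightarrow> real) \<Rightarrow> 'a \<Rightarrow> 'a set \<Rightarrow> real" where
  "set_dist \<rho> a A = (INF x\<in>A. \<rho> a x)"

definition weakly_continuous_on ::
    "'l set \<Rightarrow> ('l \<Rightarrow> 'a::uniform_space \<Rightarrow> 'a \<Rightarrow> real) \<Rightarrow> 'a set \<Rightarrow> ('a \<Rightarrow> 'a set) \<Rightarrow> bool" where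
  "weakly_continuous_on \<Lambda> d E T \<longleftrightarrow>
     (\<forall>l\<in>\<Lambda>. \<forall>\<alpha>\<ge>0.
        openin (top_of_set E) {x\<in>E. set_dist (d l) x (T x) < \<alpha>} \<and>
        openin (top_of_set E) {x\<in>E. set_dist (d l) x (T x) > \<alpha>})"

end

theory Submission
  imports Defs
begin

text \<open>
  For fixed \<open>x\<close> the distance \<open>d\<^sub>\<lambda>(x, B)\<close> changes by at most \<open>H\<^sup>\<lambda>(A, B)\<close> when \<open>A\<close> is
  replaced by \<open>B\<close>, so it is a continuous function of \<open>B\<close> in the \<open>\<H>\<close>-topology; it is
  also 1-Lipschitz in \<open>x\<close>, uniformly in \<open>B\<close>. Hence \<open>x \<mapsto> d\<^sub>\<lambda>(x, Tx)\<close> is a continuous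
  real function on \<open>E\<close>, which is more than weak continuity demands.
\<close>

lemma set_dist_le:
  assumes "pseudometric \<rho>" "a \<in> A"
  shows "set_dist \<rho> x A \<le> \<rho> x a"
  unfolding set_dist_def
proof (rule cINF_lower)
  show "bdd_below (\<rho> x ` A)"
    using assms(1) by (auto simp: pseudometric_def intro!: bdd_belowI[of _ 0])
qed (use assms in auto)

lemma set_dist_greatest:
  assumes "A \<noteq> {}" "\<And>a. a \<in> A \<Longrightarrow> r \<le> \<rho> x a"
  shows "r \<le> set_dist \<rho> x A"
  unfolding set_dist_def using assms by (intro cINF_greatest)

text \<open>For each \<open>a\<close> in \<open>A\<close> the triangle inequality gives
  \<open>set_dist \<rho> x A \<le> \<rho> x y + \<rho> y a\<close>; the infimum over
  \<open>a\<close> is then taken on the right.\<close>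

lemma set_dist_triangle:
  assumes \<rho>: "pseudometric \<rho>" and "A \<noteq> {}"
  shows "set_dist \<rho> x A \<le> \<rho> x y + set_dist \<rho> y A"
proof -
  have "set_dist \<rho> x A - \<rho> x y \<le> \<rho> y a" if "a \<in> A" for a
    using set_dist_le[OF \<rho> that, of x] \<rho> unfolding pseudometric_def by (smt (verit))
  then have "set_dist \<rho> x A - \<rho> x y \<le> set_dist \<rho> y A"
    using \<open>A \<noteq> {}\<close> by (intro set_dist_greatest)
  then show ?thesis by simp
qed

lemma abs_set_dist_diff_le:
  assumes \<rho>: "pseudometric \<rho>" and "A \<noteq> {}"
  shows "\<bar>set_dist \<rho> x A - set_dist \<rho> y A\<bar> \<le> \<rho> x y"
  using set_dist_triangle[OF assms, of x y] set_dist_triangle[OF assms, of y x] \<rho>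
  unfolding pseudometric_def by (smt (verit))

text \<open>The two inclusions trade places when the sets do, whether or not \<open>U\<close> is
  symmetric. This turns a one-sided estimate into a two-sided one.\<close>

lemma hyper_entourage_sym: "(A, B) \<in> hyper_entourage U \<Longrightarrow> (B, A) \<in> hyper_entourage U"
  by (auto simp: hyper_entourage_def)

text \<open>Each \<open>a\<close> in \<open>A\<close> has some \<open>b\<close> in \<open>B\<close>
  closer than \<open>e\<close>, so passing from \<open>a\<close> to \<open>b\<close> costs at most
  \<open>e\<close>; the infimum over \<open>a\<close> keeps this bound.\<close>

lemma set_dist_hyper_le:
  assumes \<rho>: "pseudometric \<rho>" and AB: "(A, B) \<in> hyper_entourage {(x, y). \<rho> x y < e}"
  shows "set_dist \<rho> x B \<le> set_dist \<rho> x A + e"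
proof -
  have "set_dist \<rho> x B - e \<le> \<rho> x a" if a: "a \<in> A" for a
  proof -
    obtain b where b: "b \<in> B" "\<rho> b a < e"
      using AB a by (auto simp: hyper_entourage_def)
    show ?thesis
      using set_dist_le[OF \<rho> b(1), of x] b(2) \<rho> unfolding pseudometric_def by (smt (verit))
  qed
  moreover have "A \<noteq> {}"
    using AB by (auto simp: hyper_entourage_def CB_def)
  ultimately have "set_dist \<rho> x B - e \<le> set_dist \<rho> x A"
    by (intro set_dist_greatest)
  then show ?thesis by simp
qed

lemma abs_set_dist_hyper_diff_le:
  assumes "pseudometric \<rho>" "(A, B) \<in> hyper_entourage {(x, y). \<rho> x y < e}"
  shows "\<bar>set_dist \<rho> x B - set_dist \<rho> x A\<bar> \<le> e"
  using set_dist_hyper_le[OF assms, of x]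
    set_dist_hyper_le[OF assms(1) hyper_entourage_sym[OF assms(2)], of x] by linarith

lemma continuous_map_set_dist:
  fixes \<rho> :: "'a::uniform_space \<Rightarrow> 'a \<Rightarrow> real"
  assumes \<rho>: "pseudometric \<rho>" and ent: "\<And>e. e > 0 \<Longrightarrow> entourage {(x, y). \<rho> x y < e}"
  shows "continuous_map H_topology euclidean (set_dist \<rho> x)"
  unfolding continuous_map_def
proof (intro conjI allI impI)
  fix V :: "real set" assume "openin euclidean V"
  then have V: "open V" by simp
  have "\<forall>\<^sub>F (A', B) in hyper_uniformity. A' = A \<longrightarrow> B \<in> CB \<and> set_dist \<rho> x B \<in> V"
    if A: "set_dist \<rho> x A \<in> V" for A
  proof -
    obtain e where e: "e > 0" "\<And>t. \<bar>t - set_dist \<rho> x A\<bar> < e \<Longrightarrow> t \<in> V"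
      using V A unfolding open_dist dist_real_def by blast
    \<comment> \<open>Half of \<open>e\<close> is used because the Hausdorff estimate is non-strict,
      while membership in \<open>V\<close> needs a distance strictly below \<open>e\<close>.\<close>
    have "B \<in> CB \<and> set_dist \<rho> x B \<in> V" if AB: "(A, B) \<in> hyper_entourage {(x, y). \<rho> x y < e / 2}" for B
      using abs_set_dist_hyper_diff_le[OF \<rho> AB, of x] e AB by (auto simp: hyper_entourage_def)
    then show ?thesis
      unfolding eventually_hyper_uniformity using ent[of "e / 2"] e(1)
      by (intro exI[of _ "{(x, y). \<rho> x y < e / 2}"]) auto
  qed
  then show "openin H_topology {A \<in> topspace H_topology. set_dist \<rho> x A \<in> V}"
    by (auto simp: openin_H_topology topspace_H_topology)
qed auto

lemma tendsto_pseudometric: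
  fixes \<rho> :: "'a::uniform_space \<Rightarrow> 'a \<Rightarrow> real"
  assumes \<rho>: "pseudometric \<rho>" and ent: "\<And>e. e > 0 \<Longrightarrow> entourage {(x, y). \<rho> x y < e}"
  shows "(\<rho> x \<longlongrightarrow> 0) (nhds x)"
proof (rule tendstoI)
  fix e :: real assume "e > 0"
  then have "\<forall>\<^sub>F p in uniformity. p \<in> {(x, y). \<rho> x y < e}"
    using ent by (simp add: entourage_def)
  \<comment> \<open>Fixing the first coordinate at \<open>x\<close> yields the form in which the
    uniformity describes neighbourhoods of \<open>x\<close>.\<close>
  then have "\<forall>\<^sub>F (x', y) in uniformity. x' = x \<longrightarrow> \<rho> x y < e"
    by eventually_elim auto
  then show "\<forall>\<^sub>F y in nhds x. dist (\<rho> x y) 0 < e"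
    using \<rho> by (simp add: eventually_nhds_uniformity pseudometric_def)
qed

text \<open>Near \<open>x\<close>, write \<open>set_dist \<rho> y (T y)\<close> as
  \<open>set_dist \<rho> x (T y)\<close> plus a difference. The first term, with its point frozen,
  converges by continuity of \<open>T\<close>; the difference is at most \<open>\<rho> x y\<close>
  and tends to 0.\<close>

lemma continuous_on_set_dist:
  fixes \<rho> :: "'a::uniform_space \<Rightarrow> 'a \<Rightarrow> real"
  assumes \<rho>: "pseudometric \<rho>" and ent: "\<And>e. e > 0 \<Longrightarrow> entourage {(x, y). \<rho> x y < e}"
    and T: "H_continuous_on E T"
  shows "continuous_on E (\<lambda>x. set_dist \<rho> x (T x))"
  unfolding continuous_on_def
proof
  fix x assume "x \<in> E"
  have "continuous_on E (\<lambda>y. set_dist \<rho> x (T y))"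
    using continuous_map_compose[OF T[unfolded H_continuous_on_def] continuous_map_set_dist[OF \<rho> ent]]
    by (simp add: o_def)
  then have "((\<lambda>y. set_dist \<rho> x (T y)) \<longlongrightarrow> set_dist \<rho> x (T x)) (at x within E)"
    using \<open>x \<in> E\<close> by (simp add: continuous_on_def)
  moreover have "((\<lambda>y. set_dist \<rho> y (T y) - set_dist \<rho> x (T y)) \<longlongrightarrow> 0) (at x within E)"
  proof (rule Lim_null_comparison)
    \<comment> \<open>Continuity into \<open>H_topology\<close> places the values of
      \<open>T\<close> in its carrier \<open>CB\<close>.\<close>
    have "T y \<noteq> {}" if "y \<in> E" for y
      using T that unfolding H_continuous_on_def
      by (auto simp: continuous_map_def topspace_H_topology CB_def)
    then have "norm (set_dist \<rho> y (T y) - set_dist \<rho> x (T y)) \<le> \<rho> x y" if "y \<in> E" for y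
      using abs_set_dist_diff_le[OF \<rho>, of "T y" x y] that by (simp add: abs_minus_commute)
    then show "\<forall>\<^sub>F y in at x within E. norm (set_dist \<rho> y (T y) - set_dist \<rho> x (T y)) \<le> \<rho> x y"
      by (simp add: eventually_at_filter)
    show "(\<rho> x \<longlongrightarrow> 0) (at x within E)"
      unfolding at_within_def by (rule tendsto_mono[OF inf.cobounded1 tendsto_pseudometric[OF \<rho> ent]])
  qed
  ultimately show "((\<lambda>y. set_dist \<rho> y (T y)) \<longlongrightarrow> set_dist \<rho> x (T x)) (at x within E)"
    by (auto dest: tendsto_add)
qed

text \<open>The uniformity is an infimum of principal filters, hence lies below each of
  them.\<close>

lemma entourage_generating_ball:
  assumes "generates_uniformity \<Lambda> d" "l \<in> \<Lambda>" "e > 0"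
  shows "entourage {(x, y). d l x y < e}"
proof -
  have "(INF l\<in>\<Lambda>. INF e\<in>{0<..}. principal {(x, y). d l x y < e}) \<le>
      (INF e\<in>{0<..}. principal {(x, y). d l x y < e})"
    using \<open>l \<in> \<Lambda>\<close> by (rule INF_lower)
  also have "\<dots> \<le> principal {(x, y). d l x y < e}"
    by (rule INF_lower) (use \<open>e > 0\<close> in simp)
  finally show ?thesis
    using assms(1) unfolding generates_uniformity_def entourage_def le_principal by metis
qed

theorem theorem4:
  fixes \<Lambda> :: "'l set"
    and d :: "'l \<Rightarrow> 'a::uniform_space \<Rightarrow> 'a \<Rightarrow> real"
    and E :: "'a set"
    and T :: "'a \<Rightarrow> 'a set"
  assumes "\<And>l. l \<in> \<Lambda> \<Longrightarrow> pseudometric (d l)"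
    and "saturated \<Lambda> d"
    and "generates_uniformity \<Lambda> d"
    and "\<And>x. x \<in> E \<Longrightarrow> T x \<in> CB"
    and "H_continuous_on E T"
  shows "weakly_continuous_on \<Lambda> d E T"
  unfolding weakly_continuous_on_def
proof (intro ballI allI impI)
  fix l and \<alpha> :: real
  assume "l \<in> \<Lambda>"
  then have cont: "continuous_on E (\<lambda>x. set_dist (d l) x (T x))"
    using assms entourage_generating_ball by (intro continuous_on_set_dist)
  show "openin (top_of_set E) {x \<in> E. set_dist (d l) x (T x) < \<alpha>} \<and>
      openin (top_of_set E) {x \<in> E. set_dist (d l) x (T x) > \<alpha>}"
    \<comment> \<open>Both sets are preimages of open rays under one continuous function.\<close>
    using continuous_openin_preimage_gen[OF cont, of "{..<\<alpha>}"]
      continuous_openin_preimage_gen[OF cont, of "{\<alpha><..}"]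
    by (simp add: Int_def vimage_def)
qed

end
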